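(* Let $\ell\ge 2$ be an integer and let $M$ be a simple binary matroid with set of circuits $\mathcal C$. The following are equivalent: (1) $M$ is $\ell$-closed; (2) $M$ is $(\ell+2)$-chordal; (3) $\mathcal C=\mathrm{cl}_\Delta(\mathcal C_{\ell+1})$, where $\mathcal C_{\ell+1}=\{C\in\mathcal C: |C|\le \ell+1\}$.
   Context: Matroids are finite on ground set $[n]$; simple means all circuits have at least three elements; binary means the symmetric difference of any two different circuits is a union of disjoint circuits. $\mathrm{cl}$ denotes matroid closure. A circuit $C$ has a chord $i_0$ (and $i_0$ splits $C$ into $C_1,C_2$) if there are circuits $C_1,C_2$ with $C_1\cap C_2=\{i_0\}$ and $C=C_1\Delta C_2$. $M$ is $k$-chordal if every circuit with at least $k$ elements has a chord. $M$ is $\ell$-closed if for every $X\subseteq[n]$: $X$ is closed iff for every $Y\subseteq X$ with $|Y|\le\ell$ one has $\mathrm{cl}(Y)\subseteq X$. For $\mathcal C'\subseteq\mathcal C$, $\mathrm{cl}_\Delta(\mathcal C')$ is the smallest subset of $\mathcal C$ that contains $\mathcal C'$ and has the property that whenever a circuit $C$ splits into two circuits $C_1,C_2$ both belonging to it, then $C$ also belongs to it. *)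

theory Defs
  imports Main "HOL-Library.Disjoint_Sets"
begin

locale matroid =
  fixes E :: "'a set" and indep :: "'a set \<Rightarrow> bool"
  assumes finite_ground: "finite E"
    and indep_subset_ground: "indep X \<Longrightarrow> X \<subseteq> E"
    and indep_empty: "indep {}"
    and indep_mono: "indep X \<Longrightarrow> Y \<subseteq> X \<Longrightarrow> indep Y"
    and indep_augment:
      "indep X \<Longrightarrow> indep Y \<Longrightarrow> card X < card Y \<Longrightarrow> \<exists>y\<in>Y - X. indep (insert y X)"

definition circuits :: "'a set \<Rightarrow> ('a set \<Rightarrow> bool) \<Rightarrow> 'a set set" where
  "circuits E indep = {C. C \<subseteq> E \<and> \<not> indep C \<and> (\<forall>D. D \<subset> C \<longrightarrow> indep D)}"

definition matroid_rank :: "('a set \<Rightarrow> bool) \<Rightarrow> 'a set \<Rightarrow> nat" where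
  "matroid_rank indep X = Max (card ` {I. I \<subseteq> X \<and> indep I})"

definition matroid_cl :: "'a set \<Rightarrow> ('a set \<Rightarrow> bool) \<Rightarrow> 'a set \<Rightarrow> 'a set" where
  "matroid_cl E indep X =
     {e \<in> E. matroid_rank indep (insert e X) = matroid_rank indep X}"

definition matroid_closed :: "'a set \<Rightarrow> ('a set \<Rightarrow> bool) \<Rightarrow> 'a set \<Rightarrow> bool" where
  "matroid_closed E indep X \<longleftrightarrow> matroid_cl E indep X = X"

definition simple_matroid :: "'a set \<Rightarrow> ('a set \<Rightarrow> bool) \<Rightarrow> bool" where
  "simple_matroid E indep \<longleftrightarrow> (\<forall>C\<in>circuits E indep. 3 \<le> card C)"

definition binary_matroid :: "'a set \<Rightarrow> ('a set \<Rightarrow> bool) \<Rightarrow> bool" where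
  "binary_matroid E indep \<longleftrightarrow>
     (\<forall>C\<in>circuits E indep. \<forall>D\<in>circuits E indep. C \<noteq> D \<longrightarrow>
        (\<exists>F \<subseteq> circuits E indep. disjoint F \<and> sym_diff C D = \<Union>F))"

definition splits :: "'a \<Rightarrow> 'a set \<Rightarrow> 'a set \<Rightarrow> 'a set \<Rightarrow> bool" where
  "splits i C C1 C2 \<longleftrightarrow> C1 \<inter> C2 = {i} \<and> C = sym_diff C1 C2"

definition has_chord :: "'a set \<Rightarrow> ('a set \<Rightarrow> bool) \<Rightarrow> 'a set \<Rightarrow> bool" where
  "has_chord E indep C \<longleftrightarrow>
     (\<exists>i. \<exists>C1\<in>circuits E indep. \<exists>C2\<in>circuits E indep. splits i C C1 C2)"

definition chordal :: "nat \<Rightarrow> 'a set \<Rightarrow> ('a set \<Rightarrow> bool) \<Rightarrow> bool" where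
  "chordal k E indep \<longleftrightarrow>
     (\<forall>C\<in>circuits E indep. k \<le> card C \<longrightarrow> has_chord E indep C)"

definition l_closed :: "nat \<Rightarrow> 'a set \<Rightarrow> ('a set \<Rightarrow> bool) \<Rightarrow> bool" where
  "l_closed l E indep \<longleftrightarrow>
     (\<forall>X \<subseteq> E. matroid_closed E indep X \<longleftrightarrow>
        (\<forall>Y \<subseteq> X. card Y \<le> l \<longrightarrow> matroid_cl E indep Y \<subseteq> X))"

text \<open>Meaningful for \<open>\<C>' \<subseteq> circuits E indep\<close>; the family of
  all circuits is then one of the intersected sets.\<close>

definition cl_delta :: "'a set \<Rightarrow> ('a set \<Rightarrow> bool) \<Rightarrow> 'a set set \<Rightarrow> 'a set set" where
  "cl_delta E indep \<C>' =
     \<Inter>{D. \<C>' \<subseteq> D \<and> D \<subseteq> circuits E indep \<and>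
         (\<forall>C\<in>circuits E indep. \<forall>C1\<in>D. \<forall>C2\<in>D.
            (\<exists>i. splits i C C1 C2) \<longrightarrow> C \<in> D)}"

end

theory Submission
  imports Defs
begin

text \<open>An element \<open>e\<close> outside \<open>X\<close> lies in the closure of \<open>X\<close> iff some circuit \<open>C\<close> has \<open>e \<in> C\<close> and
  \<open>C - {e} \<subseteq> X\<close>.
  The theorem is proved as the cycle (2) \<open>\<Longrightarrow>\<close> (3) \<open>\<Longrightarrow>\<close> (1) \<open>\<Longrightarrow>\<close> (2).

  (2) \<open>\<Longrightarrow>\<close> (3): by simplicity both parts of a split circuit are smaller than the circuit, so one
  can induct on the size.

  (3) \<open>\<Longrightarrow>\<close> (1): the circuits \<open>C\<close> for which \<open>C - {e} \<subseteq> X\<close> always forces \<open>e \<in> X\<close> are closed under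
  splitting.

  (1) \<open>\<Longrightarrow>\<close> (2): remove an element from a large circuit \<open>C\<close>. The remaining set is not closed, which
  produces a small circuit \<open>D\<close> that meets the complement of \<open>C\<close> in a single element \<open>f\<close>. Every
  circuit inside the symmetric difference of \<open>C\<close> and \<open>D\<close> must contain \<open>f\<close>, so by binarity this
  difference is itself a circuit, and \<open>f\<close> is a chord.\<close>

context matroid
begin

section \<open>Circuits as minimal dependent sets\<close>

lemma circuit_subset_ground: "C \<in> circuits E indep \<Longrightarrow> C \<subseteq> E"
  by (simp add: circuits_def)

lemma circuit_dep: "C \<in> circuits E indep \<Longrightarrow> \<not> indep C"
  by (simp add: circuits_def)

lemma circuit_psubset_indep: "C \<in> circuits E indep \<Longrightarrow> D \<subset> C \<Longrightarrow> indep D"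
  by (simp add: circuits_def)

lemma finite_circuit: "C \<in> circuits E indep \<Longrightarrow> finite C"
  using circuit_subset_ground finite_ground finite_subset by blast

lemma circuit_nonempty: "C \<in> circuits E indep \<Longrightarrow> C \<noteq> {}"
  using circuit_dep indep_empty by blast

lemma circuit_subset_eq:
  "C \<in> circuits E indep \<Longrightarrow> D \<in> circuits E indep \<Longrightarrow> C \<subseteq> D \<Longrightarrow> C = D"
  using circuit_dep circuit_psubset_indep by blast

lemma dep_contains_circuit:
  assumes "X \<subseteq> E" "\<not> indep X"
  obtains C where "C \<in> circuits E indep" "C \<subseteq> X"
proof -
  have "finite {D. D \<subseteq> X \<and> \<not> indep D}"
    using assms finite_ground finite_subset by (metis finite_Collect_subsets finite_Collect_conjI)
  moreover have "X \<in> {D. D \<subseteq> X \<and> \<not> indep D}"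
    using assms by simp
  ultimately obtain C where C: "C \<subseteq> X" "\<not> indep C"
    and min: "\<And>D. D \<subseteq> X \<Longrightarrow> \<not> indep D \<Longrightarrow> D \<subseteq> C \<Longrightarrow> D = C"
    by (smt (verit) finite_has_minimal2 mem_Collect_eq)
  then have "C \<in> circuits E indep"
    unfolding circuits_def using assms by blast
  with C that show thesis by blast
qed

section \<open>Rank and maximum independent subsets\<close>

lemma finite_indep_cards: "finite (card ` {I. I \<subseteq> X \<and> indep I})"
proof -
  have "{I. I \<subseteq> X \<and> indep I} \<subseteq> Pow E"
    using indep_subset_ground by blast
  then show ?thesis
    by (meson finite_Pow_iff finite_ground finite_imageI finite_subset)
qed

lemma card_le_rank: "I \<subseteq> X \<Longrightarrow> indep I \<Longrightarrow> card I \<le> matroid_rank indep X"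
  unfolding matroid_rank_def by (rule Max_ge[OF finite_indep_cards]) blast

lemma rank_attained:
  obtains I where "I \<subseteq> X" "indep I" "card I = matroid_rank indep X"
proof -
  have "card ` {I. I \<subseteq> X \<and> indep I} \<noteq> {}"
    using indep_empty by blast
  then have "matroid_rank indep X \<in> card ` {I. I \<subseteq> X \<and> indep I}"
    unfolding matroid_rank_def by (rule Max_in[OF finite_indep_cards])
  with that show thesis by auto
qed

lemma finite_indep: "indep I \<Longrightarrow> finite I"
  using finite_ground finite_subset indep_subset_ground by blast

text \<open>Augmenting \<open>I\<close> from a maximum independent subset of \<open>X\<close> never
  leaves \<open>X\<close>, and each step lowers the deficit to the rank by one.\<close>

lemma indep_extends_to_rank:
  assumes "indep I" "I \<subseteq> X"
  obtains J where "I \<subseteq> J" "J \<subseteq> X" "indep J" "card J = matroid_rank indep X"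
proof -
  have "\<exists>J. I \<subseteq> J \<and> J \<subseteq> X \<and> indep J \<and> card J = matroid_rank indep X"
    using assms
  proof (induction "matroid_rank indep X - card I" arbitrary: I)
    case 0
    then show ?case
      using card_le_rank[of I X] by (intro exI[of _ I]) auto
  next
    case (Suc k)
    obtain B where B: "B \<subseteq> X" "indep B" "card B = matroid_rank indep X"
      by (rule rank_attained)
    with Suc.hyps(2) have "card I < card B" by linarith
    then obtain y where y: "y \<in> B - I" "indep (insert y I)"
      using indep_augment Suc.prems(1) B(2) by blast
    then have "k = matroid_rank indep X - card (insert y I)"
      using Suc.hyps(2) Suc.prems(1) finite_indep by simp
    from Suc.hyps(1)[OF this y(2)] y(1) B(1) Suc.prems(2) show ?case
      by auto
  qed
  with that show thesis by blast
qed

section \<open>Closure and closed sets in terms of circuits\<close>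

lemma mem_cl_iff:
  assumes "X \<subseteq> E"
  shows "e \<in> matroid_cl E indep X \<longleftrightarrow>
    e \<in> X \<or> (\<exists>C\<in>circuits E indep. e \<in> C \<and> C - {e} \<subseteq> X)"
proof (cases "e \<in> X")
  case True
  then show ?thesis
    using assms by (auto simp: matroid_cl_def insert_absorb)
next
  case False
  have "\<exists>C\<in>circuits E indep. e \<in> C \<and> C - {e} \<subseteq> X" if e: "e \<in> matroid_cl E indep X"
  proof -
    have eE: "e \<in> E" and rank: "matroid_rank indep (insert e X) = matroid_rank indep X"
      using e by (auto simp: matroid_cl_def)
    obtain I where I: "I \<subseteq> X" "indep I" "card I = matroid_rank indep X"
      by (rule rank_attained)
    have "card (insert e I) = Suc (card I)"
      using I False finite_indep by (intro card_insert_disjoint) auto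
    \<comment> \<open>Otherwise \<open>insert e I\<close> would exceed the rank of
      \<open>insert e X\<close>. Its circuit must pass through \<open>e\<close>, since
      \<open>I\<close> is independent.\<close>
    then have "\<not> indep (insert e I)"
      using card_le_rank[of "insert e I" "insert e X"] I rank by auto
    then obtain C where C: "C \<in> circuits E indep" "C \<subseteq> insert e I"
      using dep_contains_circuit[of "insert e I"] eE I(2) indep_subset_ground by blast
    have "\<not> C \<subseteq> I"
      using C(1) I(2) circuit_dep indep_mono by blast
    with C I(1) show ?thesis by blast
  qed
  moreover have "e \<in> matroid_cl E indep X"
    if C: "C \<in> circuits E indep" "e \<in> C" "C - {e} \<subseteq> X" for C
  proof -
    have "indep (C - {e})"
      using C circuit_psubset_indep by blast
    then obtain I where I: "C - {e} \<subseteq> I" "I \<subseteq> X" "indep I" "card I = matroid_rank indep X"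
      using C(3) by (rule indep_extends_to_rank)
    obtain J where J: "J \<subseteq> insert e X" "indep J" "card J = matroid_rank indep (insert e X)"
      by (rule rank_attained)
    \<comment> \<open>\<open>I\<close> cannot be augmented from \<open>J\<close>: adding
      \<open>e\<close> would complete the circuit \<open>C\<close>, and adding any other element
      would exceed the rank of \<open>X\<close>.\<close>
    have "card J \<le> card I"
    proof (rule ccontr)
      assume "\<not> card J \<le> card I"
      then obtain y where y: "y \<in> J - I" "indep (insert y I)"
        using indep_augment[OF I(3) J(2)] by auto
      have "y \<noteq> e"
        using y(2) I(1) C(1) circuit_dep indep_mono by blast
      then have "card (insert y I) \<le> matroid_rank indep X"
        using card_le_rank y J(1) I(2) by auto
      then show False
        using y(1) I finite_indep by simp
    qed
    moreover have "card I \<le> matroid_rank indep (insert e X)"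
      using card_le_rank I by blast
    ultimately show ?thesis
      using I(4) J(3) C circuit_subset_ground unfolding matroid_cl_def by auto
  qed
  ultimately show ?thesis
    using False by blast
qed

lemma closed_iff_circuits:
  assumes "X \<subseteq> E"
  shows "matroid_closed E indep X \<longleftrightarrow>
    (\<forall>C\<in>circuits E indep. \<forall>e\<in>C. C - {e} \<subseteq> X \<longrightarrow> e \<in> X)"
  unfolding matroid_closed_def set_eq_iff mem_cl_iff[OF assms] by blast

lemma cl_mono:
  assumes "X \<subseteq> Y" "Y \<subseteq> E"
  shows "matroid_cl E indep X \<subseteq> matroid_cl E indep Y"
proof
  fix e
  assume "e \<in> matroid_cl E indep X"
  then have "e \<in> X \<or> (\<exists>C\<in>circuits E indep. e \<in> C \<and> C - {e} \<subseteq> X)"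
    using mem_cl_iff assms by (meson subset_trans)
  then show "e \<in> matroid_cl E indep Y"
    unfolding mem_cl_iff[OF assms(2)] using assms(1) by (meson subsetD subset_trans)
qed

section \<open>Chordality, generation by small circuits, and closedness\<close>

lemma chordal_imp_generated:
  assumes simple: "simple_matroid E indep" and chordal: "chordal (l + 2) E indep"
  shows "circuits E indep = cl_delta E indep {C \<in> circuits E indep. card C \<le> l + 1}"
proof
  show "cl_delta E indep {C \<in> circuits E indep. card C \<le> l + 1} \<subseteq> circuits E indep"
    unfolding cl_delta_def by blast
next
  have "C \<in> D" if "C \<in> circuits E indep"
    and small: "{C \<in> circuits E indep. card C \<le> l + 1} \<subseteq> D"
    and split: "\<forall>C\<in>circuits E indep. \<forall>C1\<in>D. \<forall>C2\<in>D. (\<exists>i. splits i C C1 C2) \<longrightarrow> C \<in> D"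
  for C D
    using that(1)
  proof (induction "card C" arbitrary: C rule: less_induct)
    case less
    show ?case
    proof (cases "card C \<le> l + 1")
      case True
      with less.prems small show ?thesis by blast
    next
      case False
      then have "has_chord E indep C"
        using chordal less.prems unfolding chordal_def by auto
      then obtain i C1 C2 where C12: "C1 \<in> circuits E indep" "C2 \<in> circuits E indep"
        and s: "splits i C C1 C2"
        unfolding has_chord_def by blast
      have fin: "finite C1" "finite C2"
        using C12 finite_circuit by auto
      have eq: "C = (C1 - {i}) \<union> (C2 - {i})" "(C1 - {i}) \<inter> (C2 - {i}) = {}" "i \<in> C1" "i \<in> C2"
        using s unfolding splits_def by auto
      \<comment> \<open>Each part loses only \<open>i\<close>; as the other part contributes at
        least two elements, both parts are strictly smaller than \<open>C\<close>.\<close>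
      have "card C = (card C1 - 1) + (card C2 - 1)"
        using fin eq by (simp add: card_Un_disjoint)
      moreover have "3 \<le> card C1" "3 \<le> card C2"
        using simple C12 unfolding simple_matroid_def by auto
      ultimately have "card C1 < card C" "card C2 < card C"
        by linarith+
      then have "C1 \<in> D" "C2 \<in> D"
        using less.hyps C12 by blast+
      with split s less.prems show ?thesis by blast
    qed
  qed
  then show "circuits E indep \<subseteq> cl_delta E indep {C \<in> circuits E indep. card C \<le> l + 1}"
    unfolding cl_delta_def by blast
qed

lemma generated_imp_l_closed:
  assumes gen: "circuits E indep = cl_delta E indep {C \<in> circuits E indep. card C \<le> l + 1}"
  shows "l_closed l E indep"
  unfolding l_closed_def
proof (intro allI impI iffI)
  fix X Y
  assume "X \<subseteq> E" "matroid_closed E indep X" "Y \<subseteq> X"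
  then show "matroid_cl E indep Y \<subseteq> X"
    using cl_mono unfolding matroid_closed_def by blast
next
  fix X
  assume X: "X \<subseteq> E" and cl: "\<forall>Y\<subseteq>X. card Y \<le> l \<longrightarrow> matroid_cl E indep Y \<subseteq> X"
  \<comment> \<open>The circuits that do not violate closedness of \<open>X\<close>.
    \<open>D\<close> will be one of the families intersected in \<open>cl_delta\<close>, hence
    contains all circuits.\<close>
  define D where "D = {C \<in> circuits E indep. \<forall>e\<in>C. C - {e} \<subseteq> X \<longrightarrow> e \<in> X}"
  have "C \<in> D" if C: "C \<in> circuits E indep" "card C \<le> l + 1" for C
  proof -
    have "e \<in> X" if e: "e \<in> C" "C - {e} \<subseteq> X" for e
    proof -
      have "card (C - {e}) \<le> l"
        using C e finite_circuit by simp
      then have "matroid_cl E indep (C - {e}) \<subseteq> X"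
        using cl e by blast
      moreover have "e \<in> matroid_cl E indep (C - {e})"
        using mem_cl_iff[of "C - {e}" e] C e X by blast
      ultimately show ?thesis by blast
    qed
    with C show ?thesis
      unfolding D_def by blast
  qed
  moreover have "C \<in> D"
    if C: "C \<in> circuits E indep" and C12: "C1 \<in> D" "C2 \<in> D" and s: "splits i C C1 C2"
    for C C1 C2 i
  proof -
    \<comment> \<open>As \<open>e\<close> lies in \<open>A\<close> and \<open>C\<close>, it is not
      in \<open>B\<close>, so \<open>B - {i}\<close> lies in \<open>X\<close>. Then \<open>B\<close>
      forces \<open>i\<close> into \<open>X\<close>, after which \<open>A\<close> forces
      \<open>e\<close>.\<close>
    have forced: "e \<in> X"
      if e: "e \<in> A" "e \<in> C" "C - {e} \<subseteq> X" and AB: "A \<in> D" "B \<in> D" "splits i C A B" for e A B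
    proof -
      have "i \<in> B" "B - {i} \<subseteq> X" "A - {e} \<subseteq> insert i X"
        using e AB(3) unfolding splits_def by blast+
      moreover from this have "i \<in> X"
        using AB(2) unfolding D_def by blast
      ultimately show ?thesis
        using AB(1) e(1) unfolding D_def by blast
    qed
    have "splits i C C2 C1"
      using s unfolding splits_def by blast
    moreover have "C \<subseteq> C1 \<union> C2"
      using s unfolding splits_def by blast
    ultimately have "\<forall>e\<in>C. C - {e} \<subseteq> X \<longrightarrow> e \<in> X"
      using forced C12 s by blast
    with C show ?thesis
      unfolding D_def by blast
  qed
  moreover have "D \<subseteq> circuits E indep"
    unfolding D_def by blast
  ultimately have "cl_delta E indep {C \<in> circuits E indep. card C \<le> l + 1} \<subseteq> D"
    unfolding cl_delta_def by (intro Inter_lower) blast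
  with gen have "circuits E indep \<subseteq> D"
    by (rule ord_eq_le_trans)
  then show "matroid_closed E indep X"
    unfolding closed_iff_circuits[OF X] D_def by blast
qed

lemma l_closed_imp_chordal:
  assumes simple: "simple_matroid E indep" and binary: "binary_matroid E indep"
    and closed: "l_closed l E indep"
  shows "chordal (l + 2) E indep"
  unfolding chordal_def
proof (intro ballI impI)
  fix C
  assume C: "C \<in> circuits E indep" "l + 2 \<le> card C"
  then obtain e where e: "e \<in> C"
    using circuit_nonempty by blast
  have X: "C - {e} \<subseteq> E"
    using C circuit_subset_ground by blast
  \<comment> \<open>The circuit \<open>C\<close> itself puts \<open>e\<close> into the
    closure.\<close>
  have "\<not> matroid_closed E indep (C - {e})"
    using closed_iff_circuits[OF X] C(1) e by blast
  with closed X have "\<not> (\<forall>Y\<subseteq>C - {e}. card Y \<le> l \<longrightarrow> matroid_cl E indep Y \<subseteq> C - {e})"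
    unfolding l_closed_def by metis
  then obtain Y f where Y: "Y \<subseteq> C - {e}" "card Y \<le> l"
    and f: "f \<in> matroid_cl E indep Y" "f \<notin> C - {e}"
    by blast
  have "Y \<subseteq> E" "f \<notin> Y"
    using X Y(1) f(2) by blast+
  then obtain D where D: "D \<in> circuits E indep" "f \<in> D" "D - {f} \<subseteq> Y"
    using f(1) mem_cl_iff by meson
  have "finite Y"
    using Y(1) C(1) finite_circuit finite_subset by blast
  then have "card (D - {f}) \<le> l"
    using D(3) Y(2) card_mono le_trans by blast
  \<comment> \<open>\<open>D\<close> has at most \<open>l + 1\<close> elements and \<open>C\<close>
    at least \<open>l + 2\<close>. This excludes \<open>D = C\<close>, and with it the case
    \<open>f = e\<close>.\<close>
  then have "card D < card C"
    using D(1,2) C(2) finite_circuit by simp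
  have fC: "f \<notin> C"
  proof
    assume "f \<in> C"
    then have "D \<subseteq> C"
      using D(3) Y(1) by blast
    then have "D = C"
      using C(1) D(1) circuit_subset_eq by blast
    with \<open>card D < card C\<close> show False by simp
  qed
  then have "C \<noteq> D"
    using D(2) by blast
  then obtain F where F: "F \<subseteq> circuits E indep" "disjoint F" "sym_diff C D = \<Union>F"
    using binary C(1) D(1) unfolding binary_matroid_def by blast
  have sd: "sym_diff C D = insert f (C - D)"
    using D(2,3) Y(1) fC by blast
  \<comment> \<open>Without loops, \<open>D\<close> meets \<open>C\<close>, so \<open>C - D\<close>
    is a proper subset of \<open>C\<close> and hence independent.\<close>
  have "D \<noteq> {f}"
    using simple D(1) unfolding simple_matroid_def by fastforce
  then have "C - D \<subset> C"
    using D(2,3) Y(1) by blast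
  have f_mem: "f \<in> D'" if "D' \<in> F" for D'
  proof (rule ccontr)
    assume "f \<notin> D'"
    then have "D' \<subset> C"
      using that F(3) sd \<open>C - D \<subset> C\<close> by blast
    then show False
      using C(1) F(1) that circuit_psubset_indep circuit_dep by blast
  qed
  obtain D1 where D1: "D1 \<in> F" "f \<in> D1"
    using F(3) sd by blast
  \<comment> \<open>The members of \<open>F\<close> are pairwise disjoint but all contain
    \<open>f\<close>, so there is only one.\<close>
  have "F = {D1}"
    using f_mem D1 F(2) unfolding disjoint_def by blast
  then have D1_eq: "D1 = insert f (C - D)"
    using F(3) sd by simp
  have "splits f C D D1"
    unfolding splits_def D1_eq using D(2,3) Y(1) fC by blast
  then show "has_chord E indep C"
    unfolding has_chord_def using D(1) D1(1) F(1) by blast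
qed

end

theorem theorem2p6:
  fixes n l :: nat and indep :: "nat set \<Rightarrow> bool"
  assumes "l \<ge> 2"
    and "matroid {1..n} indep"
    and "simple_matroid {1..n} indep"
    and "binary_matroid {1..n} indep"
  shows "(l_closed l {1..n} indep \<longleftrightarrow> chordal (l + 2) {1..n} indep) \<and>
    (chordal (l + 2) {1..n} indep \<longleftrightarrow>
      circuits {1..n} indep =
        cl_delta {1..n} indep {C \<in> circuits {1..n} indep. card C \<le> l + 1})"
  using matroid.chordal_imp_generated[OF assms(2,3)]
    matroid.generated_imp_l_closed[OF assms(2)]
    matroid.l_closed_imp_chordal[OF assms(2-4)]
  by blast

end
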